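(* Let $A\in\mathbb{R}^{n\times n}$ be a real symmetric matrix. Then $A$ is positive definite if and only if it can be factorized as $A=RR^\top$, where $R=(r_{ij})\in\mathbb{R}^{n\times n}$ is lower triangular with strictly positive diagonal entries $r_{11},\dots,r_{nn}>0$. Such a factorization is unique.
   Context: A symmetric $A\in\mathbb{R}^{n\times n}$ is positive definite if $x^\top A x>0$ for all non-zero $x\in\mathbb{R}^n$. *)

theory Defs
  imports Complex_Main "Jordan_Normal_Form.Matrix"
begin

(* Matrices carry their dimensions as values; "$$" is meaningful only for indices
   below dim_row and dim_col, so all index ranges are bounded explicitly. *)

definition symmetric_mat :: "'a mat \<Rightarrow> bool" where
  "symmetric_mat A \<longleftrightarrow> transpose_mat A = A"

definition positive_definite :: "real mat \<Rightarrow> bool" where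
  "positive_definite A \<longleftrightarrow>
     symmetric_mat A \<and>
     (\<forall>x \<in> carrier_vec (dim_row A). x \<noteq> 0\<^sub>v (dim_row A) \<longrightarrow> x \<bullet> (A *\<^sub>v x) > 0)"

definition lower_triangular :: "'a::zero mat \<Rightarrow> bool" where
  "lower_triangular R \<longleftrightarrow> (\<forall>i < dim_row R. \<forall>j < dim_col R. i < j \<longrightarrow> R $$ (i, j) = 0)"

definition cholesky_factor :: "real mat \<Rightarrow> real mat \<Rightarrow> bool" where
  "cholesky_factor A R \<longleftrightarrow>
     R \<in> carrier_mat (dim_row A) (dim_row A) \<and>
     lower_triangular R \<and>
     (\<forall>i < dim_row A. R $$ (i, i) > 0) \<and>
     A = R * transpose_mat R"

end

(* Existence is by induction on the dimension: the pivot a of a positive definite matrix is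
   positive, and its Schur complement C - b b^T / a is again positive definite, since the
   quadratic form of A takes at (-(b . y) / a, y) the value of the Schur complement at y.
   Conversely x^T R R^T x = |R^T x|^2, and R^T x does not vanish at the largest index in the
   support of x.  For uniqueness, the columns of R are read off one after the other from A. *)
theory Submission
  imports Defs
begin

text \<open>Entries and vectors are functions on \<open>nat\<close>, with the dimension kept apart:
  passing to the trailing block is then composition with \<open>Suc\<close>, free of carrier
  conditions.\<close>

definition quad_form :: "nat \<Rightarrow> (nat \<Rightarrow> nat \<Rightarrow> real) \<Rightarrow> (nat \<Rightarrow> real) \<Rightarrow> real" where
  "quad_form n f x = (\<Sum>i<n. \<Sum>j<n. x i * f i j * x j)"

definition cholesky_entries ::
  "nat \<Rightarrow> (nat \<Rightarrow> nat \<Rightarrow> real) \<Rightarrow> (nat \<Rightarrow> nat \<Rightarrow> real) \<Rightarrow> bool" where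
  "cholesky_entries n f r \<longleftrightarrow>
     (\<forall>i<n. r i i > 0) \<and> (\<forall>i<n. \<forall>j<n. i < j \<longrightarrow> r i j = 0) \<and>
     (\<forall>i<n. \<forall>j<n. f i j = (\<Sum>k<n. r i k * r j k))"

lemma quad_form_cong:
  assumes "\<And>i j. i < n \<Longrightarrow> j < n \<Longrightarrow> f i j = g i j" "\<And>i. i < n \<Longrightarrow> x i = y i"
  shows "quad_form n f x = quad_form n g y"
  unfolding quad_form_def using assms by (intro sum.cong refl) auto

lemma quad_form_gram:
  "quad_form n (\<lambda>i j. \<Sum>k<m. r i k * r j k) x = (\<Sum>k<m. (\<Sum>i<n. x i * r i k)\<^sup>2)"
proof -
  have "quad_form n (\<lambda>i j. \<Sum>k<m. r i k * r j k) x
      = (\<Sum>i<n. \<Sum>j<n. \<Sum>k<m. (x i * r i k) * (x j * r j k))"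
    unfolding quad_form_def
    by (intro sum.cong refl) (simp add: sum_distrib_left sum_distrib_right mult_ac)
  also have "\<dots> = (\<Sum>i<n. \<Sum>k<m. \<Sum>j<n. (x i * r i k) * (x j * r j k))"
    by (intro sum.cong refl sum.swap)
  also have "\<dots> = (\<Sum>k<m. \<Sum>i<n. \<Sum>j<n. (x i * r i k) * (x j * r j k))"
    by (rule sum.swap)
  also have "\<dots> = (\<Sum>k<m. (\<Sum>i<n. x i * r i k)\<^sup>2)"
    by (simp add: power2_eq_square sum_product)
  finally show ?thesis .
qed

text \<open>Splits off the variable \<open>x 0\<close>; the symmetry of the first row and column
  merges the two mixed sums into the factor 2.\<close>

lemma quad_form_Suc:
  assumes sym: "\<And>i. i < n \<Longrightarrow> f 0 (Suc i) = f (Suc i) 0"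
  shows "quad_form (Suc n) f x = f 0 0 * (x 0)\<^sup>2 + 2 * x 0 * (\<Sum>i<n. f (Suc i) 0 * x (Suc i))
           + quad_form n (\<lambda>i j. f (Suc i) (Suc j)) (\<lambda>i. x (Suc i))"
proof -
  have "(\<Sum>j<n. x 0 * f 0 (Suc j) * x (Suc j)) = x 0 * (\<Sum>i<n. f (Suc i) 0 * x (Suc i))"
    by (simp add: sum_distrib_left sym mult_ac)
  moreover have "(\<Sum>i<n. x (Suc i) * f (Suc i) 0 * x 0) = x 0 * (\<Sum>i<n. f (Suc i) 0 * x (Suc i))"
    by (simp add: sum_distrib_left mult_ac)
  ultimately show ?thesis
    unfolding quad_form_def
    by (simp add: sum.lessThan_Suc_shift sum.distrib power2_eq_square del: sum.lessThan_Suc)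
qed

text \<open>Completing the square: with b the mixed sum and q the form of the trailing block, a t^2
  + 2 t b + q = a (t + b/a)^2 + (q - b^2/a). The head coordinate t = -b/a makes the square vanish,
  and q - b^2/a is the form of the Schur complement.\<close>

lemma quad_form_Schur:
  assumes sym: "\<And>i. i < n \<Longrightarrow> f 0 (Suc i) = f (Suc i) 0" and a: "f 0 0 \<noteq> 0"
  shows "quad_form n (\<lambda>i j. f (Suc i) (Suc j) - f (Suc i) 0 * f (Suc j) 0 / f 0 0) y
       = quad_form (Suc n) f (case_nat (- (\<Sum>i<n. f (Suc i) 0 * y i) / f 0 0) y)"
proof -
  let ?b = "\<Sum>i<n. f (Suc i) 0 * y i"
  have "quad_form n (\<lambda>i j. f (Suc i) (Suc j) - f (Suc i) 0 * f (Suc j) 0 / f 0 0) y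
      = quad_form n (\<lambda>i j. f (Suc i) (Suc j)) y
        - (\<Sum>i<n. \<Sum>j<n. (f (Suc i) 0 * y i) * (f (Suc j) 0 * y j) / f 0 0)"
    unfolding quad_form_def sum_subtractf [symmetric]
    by (intro sum.cong refl) (simp add: algebra_simps)
  moreover have "(\<Sum>i<n. \<Sum>j<n. (f (Suc i) 0 * y i) * (f (Suc j) 0 * y j) / f 0 0) = ?b\<^sup>2 / f 0 0"
    by (simp only: power2_eq_square sum_product sum_divide_distrib)
  moreover have "f 0 0 * (- b / f 0 0)\<^sup>2 + 2 * (- b / f 0 0) * b + q = q - b\<^sup>2 / f 0 0" for b q
    using a by (simp add: power2_eq_square field_simps)
  ultimately show ?thesis
    by (simp add: quad_form_Suc [of n f, OF sym])
qed

lemma cholesky_entries_exists: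
  assumes "\<And>i j. i < n \<Longrightarrow> j < n \<Longrightarrow> f i j = f j i"
    and "\<And>x. \<exists>i<n. x i \<noteq> 0 \<Longrightarrow> quad_form n f x > 0"
  shows "\<exists>r. cholesky_entries n f r"
  using assms
proof (induction n arbitrary: f)
  case 0
  then show ?case by (simp add: cholesky_entries_def)
next
  case (Suc n)
  note sym = Suc.prems(1) and pos = Suc.prems(2)
  let ?a = "f 0 0"
  let ?g = "\<lambda>i j. f (Suc i) (Suc j) - f (Suc i) 0 * f (Suc j) 0 / ?a"
  have sym0: "f 0 (Suc i) = f (Suc i) 0" if "i < n" for i
    using sym that by simp
  \<comment> \<open>The first unit vector picks out the pivot.\<close>
  have "quad_form (Suc n) f (case_nat 1 (\<lambda>_. 0)) = ?a"
    by (subst quad_form_Suc [OF sym0]) (auto simp: quad_form_def)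
  moreover have "quad_form (Suc n) f (case_nat 1 (\<lambda>_. 0)) > 0"
    by (rule pos) (auto intro!: exI [of _ 0])
  ultimately have a: "?a > 0" by simp
  have "\<exists>r. cholesky_entries n ?g r"
  proof (rule Suc.IH)
    show "?g i j = ?g j i" if "i < n" "j < n" for i j
      using sym [of "Suc i" "Suc j"] that by (simp add: mult.commute)
  next
    fix y :: "nat \<Rightarrow> real" assume "\<exists>i<n. y i \<noteq> 0"
    then obtain i where "i < n" "y i \<noteq> 0" by blast
    \<comment> \<open>The extended vector is non-zero whatever its head coordinate, because
      \<open>y i\<close> reappears at index \<open>Suc i\<close>.\<close>
    then show "quad_form n ?g y > 0"
      using a by (subst quad_form_Schur [of n f, OF sym0])
        (auto intro!: pos exI [of _ "Suc i"])
  qed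
  then obtain r where r: "cholesky_entries n ?g r" by blast
  \<comment> \<open>Block form of the factor: the first column is that of \<open>f\<close> scaled by
    1/sqrt(a), so that its top entry is sqrt(a); the rest of the first row is zero; the trailing
    block is the factor \<open>r\<close> of the Schur complement.\<close>
  define s where "s i k = (case k of 0 \<Rightarrow> f i 0 / sqrt ?a
      | Suc k \<Rightarrow> (case i of 0 \<Rightarrow> 0 | Suc i \<Rightarrow> r i k))" for i k
  have diag: "s i i > 0" if "i < Suc n" for i
    using that r a by (cases i) (auto simp: s_def cholesky_entries_def)
  have tri: "s i j = 0" if "i < Suc n" "j < Suc n" "i < j" for i j
    using that r by (cases i; cases j) (auto simp: s_def cholesky_entries_def)
  have "f i j = (\<Sum>k<Suc n. s i k * s j k)" if "i < Suc n" "j < Suc n" for i j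
  proof -
    have g: "?g p q = (\<Sum>k<n. r p k * r q k)" if "p < n" "q < n" for p q
      using r that unfolding cholesky_entries_def by blast
    \<comment> \<open>The term \<open>k = 0\<close> restores exactly the product that the Schur
      complement subtracts; the remaining sum vanishes when \<open>i\<close> or \<open>j\<close> is
      0.\<close>
    have "(\<Sum>k<Suc n. s i k * s j k) = f i 0 * f j 0 / ?a + (\<Sum>k<n. s i (Suc k) * s j (Suc k))"
      using a by (simp add: sum.lessThan_Suc_shift s_def del: sum.lessThan_Suc)
    then show ?thesis
      using that a sym0 by (cases i; cases j) (auto simp: s_def g [symmetric])
  qed
  with diag tri have "cholesky_entries (Suc n) f s"
    unfolding cholesky_entries_def by blast
  then show ?case by blast
qed

lemma cholesky_entries_quad_form_pos:
  assumes r: "cholesky_entries n f r" and x: "\<exists>i<n. x i \<noteq> 0"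
  shows "quad_form n f x > 0"
proof -
  let ?S = "{i. i < n \<and> x i \<noteq> 0}"
  define m where "m = Max ?S"
  have "m \<in> ?S" unfolding m_def using x by (intro Max_in) auto
  then have m: "m < n" "x m \<noteq> 0" by auto
  have max: "i \<le> m" if "i < n" "x i \<noteq> 0" for i
    unfolding m_def using that by (intro Max_ge) auto
  \<comment> \<open>Before \<open>m\<close> the entry of \<open>r\<close> vanishes by triangularity,
    after \<open>m\<close> the entry of \<open>x\<close> by maximality, so column \<open>m\<close>
    contributes the single product \<open>x m * r m m\<close>.\<close>
  have "x i * r i m = 0" if "i < n" "i \<noteq> m" for i
  proof (cases "i < m")
    case True
    then show ?thesis using r m that by (simp add: cholesky_entries_def)
  next
    case False
    then show ?thesis using max [of i] that by auto
  qed
  then have "(\<Sum>i<n. x i * r i m) = (\<Sum>i\<in>{m}. x i * r i m)"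
    using m by (intro sum.mono_neutral_right) auto
  also have "\<dots> \<noteq> 0"
    using m r by (auto simp: cholesky_entries_def)
  finally have "(\<Sum>k<n. (\<Sum>i<n. x i * r i k)\<^sup>2) > 0"
    using m by (intro sum_pos2 [of _ m]) auto
  moreover have "quad_form n f x = (\<Sum>k<n. (\<Sum>i<n. x i * r i k)\<^sup>2)"
    using r unfolding quad_form_gram [symmetric] cholesky_entries_def
    by (intro quad_form_cong) auto
  ultimately show ?thesis by simp
qed

text \<open>Strong induction on the column \<open>j\<close>: the earlier columns determine the
  diagonal entry, which in turn determines the rest of the column by division. The row stays
  arbitrary because the hypothesis is needed for both rows \<open>i\<close> and
  \<open>j\<close>.\<close>

lemma cholesky_entries_unique:
  assumes r: "cholesky_entries n f r" and s: "cholesky_entries n f s"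
    and "i < n" "j < n"
  shows "r i j = s i j"
  using \<open>i < n\<close> \<open>j < n\<close>
proof (induction j arbitrary: i rule: less_induct)
  case (less j)
  \<comment> \<open>The sum stops at \<open>j\<close> because row \<open>j\<close> is zero beyond
    its diagonal.\<close>
  have entry: "f i j = (\<Sum>k<j. t i k * t j k) + t i j * t j j"
    if t: "cholesky_entries n f t" and "i < n" for t i
  proof -
    have "f i j = (\<Sum>k<n. t i k * t j k)"
      using t that \<open>j < n\<close> by (auto simp: cholesky_entries_def)
    also have "\<dots> = (\<Sum>k<Suc j. t i k * t j k)"
      using t \<open>j < n\<close> by (intro sum.mono_neutral_right) (auto simp: cholesky_entries_def)
    finally show ?thesis by simp
  qed
  have IH: "r i k = s i k" if "i < n" "k < j" for i k
    using less.IH [of k i] that \<open>j < n\<close> by simp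
  have eq: "r i j * r j j = s i j * s j j" if "i < n" for i
    using entry [OF r that] entry [OF s that] IH that \<open>j < n\<close> by simp
  have pos: "r j j > 0" "s j j > 0"
    using r s \<open>j < n\<close> by (auto simp: cholesky_entries_def)
  \<comment> \<open>The case \<open>i = j\<close> of \<open>eq\<close> fixes only the square;
    positivity selects the root and then permits cancelling it for general \<open>i\<close>.\<close>
  have "(r j j)\<^sup>2 = (s j j)\<^sup>2"
    using eq [OF \<open>j < n\<close>] by (simp add: power2_eq_square)
  with pos have "r j j = s j j" by (simp add: power2_eq_iff_nonneg)
  with eq [OF \<open>i < n\<close>] pos show ?case by simp
qed

lemma positive_definite_iff_quad_form:
  assumes A: "A \<in> carrier_mat n n" and "symmetric_mat A"
  shows "positive_definite A \<longleftrightarrow>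
    (\<forall>x. (\<exists>i<n. x i \<noteq> 0) \<longrightarrow> quad_form n (\<lambda>i j. A $$ (i, j)) x > 0)"
proof -
  have form: "v \<bullet> (A *\<^sub>v v) = quad_form n (\<lambda>i j. A $$ (i, j)) (($) v)" if "v \<in> carrier_vec n" for v
    using A that
    by (auto simp: scalar_prod_def quad_form_def sum_distrib_left mult_ac lessThan_atLeast0
        intro!: sum.cong)
  have zero: "v \<noteq> 0\<^sub>v n \<longleftrightarrow> (\<exists>i<n. v $ i \<noteq> 0)" if "v \<in> carrier_vec n" for v :: "real vec"
    using that by (auto simp: vec_eq_iff)
  \<comment> \<open>Turns an arbitrary function into a vector: the form reads only the first
    \<open>n\<close> values.\<close>
  have vec: "quad_form n f (($) (vec n x)) = quad_form n f x" for f x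
    by (intro quad_form_cong) auto
  have "positive_definite A \<longleftrightarrow>
      (\<forall>v\<in>carrier_vec n. (\<exists>i<n. v $ i \<noteq> 0) \<longrightarrow> quad_form n (\<lambda>i j. A $$ (i, j)) (($) v) > 0)"
    using assms by (auto simp: positive_definite_def form zero)
  also have "\<dots> \<longleftrightarrow> (\<forall>x. (\<exists>i<n. x i \<noteq> 0) \<longrightarrow> quad_form n (\<lambda>i j. A $$ (i, j)) x > 0)"
  proof (intro iffI allI ballI impI)
    fix x :: "nat \<Rightarrow> real"
    assume *: "\<forall>v\<in>carrier_vec n. (\<exists>i<n. v $ i \<noteq> 0) \<longrightarrow>
        quad_form n (\<lambda>i j. A $$ (i, j)) (($) v) > 0" and "\<exists>i<n. x i \<noteq> 0"
    then show "quad_form n (\<lambda>i j. A $$ (i, j)) x > 0"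
      using bspec [OF *, of "vec n x"] by (auto simp: vec)
  qed auto
  finally show ?thesis .
qed

text \<open>For \<open>R\<close> of the right size the matrix equation is compared entry by entry;
  for any other \<open>R\<close> both sides are false.\<close>

lemma cholesky_factor_iff_entries:
  assumes A: "A \<in> carrier_mat n n"
  shows "cholesky_factor A R \<longleftrightarrow>
    R \<in> carrier_mat n n \<and> cholesky_entries n (\<lambda>i j. A $$ (i, j)) (\<lambda>i j. R $$ (i, j))"
proof (cases "R \<in> carrier_mat n n")
  case R: True
  have "(R * transpose_mat R) $$ (i, j) = (\<Sum>k<n. R $$ (i, k) * R $$ (j, k))"
    if "i < n" "j < n" for i j
    using R that by (auto simp: scalar_prod_def lessThan_atLeast0 intro!: sum.cong)
  then have "A = R * transpose_mat R \<longleftrightarrow>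
      (\<forall>i<n. \<forall>j<n. A $$ (i, j) = (\<Sum>k<n. R $$ (i, k) * R $$ (j, k)))"
    using A R by (auto simp: mat_eq_iff)
  then show ?thesis
    using A R by (auto simp: cholesky_factor_def lower_triangular_def cholesky_entries_def)
qed (use A in \<open>auto simp: cholesky_factor_def\<close>)

theorem proposition1:
  fixes A :: "real mat" and n :: nat
  assumes "A \<in> carrier_mat n n" and "symmetric_mat A"
  shows "(positive_definite A \<longleftrightarrow> (\<exists>R. cholesky_factor A R)) \<and>
         (\<forall>R S. cholesky_factor A R \<longrightarrow> cholesky_factor A S \<longrightarrow> R = S)"
proof (intro conjI iffI allI impI)
  let ?f = "\<lambda>i j. A $$ (i, j)"
  note pd = positive_definite_iff_quad_form [OF assms]
  note chol = cholesky_factor_iff_entries [OF assms(1)]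
  {
    assume "positive_definite A"
    moreover have "?f i j = ?f j i" if "i < n" "j < n" for i j
      using assms that by (metis carrier_matD index_transpose_mat(1) symmetric_mat_def)
    ultimately obtain r where "cholesky_entries n ?f r"
      using cholesky_entries_exists [of n ?f] pd by blast
    then have "cholesky_factor A (mat n n (\<lambda>(i, j). r i j))"
      by (simp add: chol cholesky_entries_def)
    then show "\<exists>R. cholesky_factor A R" by blast
  }
  show "positive_definite A" if "\<exists>R. cholesky_factor A R"
    using that cholesky_entries_quad_form_pos unfolding pd chol by blast
  show "R = S" if "cholesky_factor A R" "cholesky_factor A S" for R S
    using that unfolding chol
    by (auto intro!: eq_matI dest: cholesky_entries_unique)
qed

end
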